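(* Let $\alpha\in(0,1)$, $\tau,h>0$, and let $f=f^++f^-$ with $f^\pm:\mathbb{R}\to\mathbb{R}$ continuously differentiable, $(f^+)'\ge 0$ and $(f^-)'\le 0$. Let $(U_j^n)_{j\in\mathbb{Z},n\ge 0}$ and $(V_j^n)_{j\in\mathbb{Z},n\ge 0}$ be two real solutions of the first order explicit upwind scheme, i.e. for all $j\in\mathbb{Z}$, $n\ge 0$, $$D_t^\alpha U_j^{n+1}+\frac1h\big(f^+(U_j^n)-f^+(U_{j-1}^n)\big)+\frac1h\big(f^-(U_{j+1}^n)-f^-(U_j^n)\big)=0,$$ and likewise for $V$. Let $I\subseteq\mathbb{R}$ be an interval containing all the initial values $U_j^0,V_j^0$ ($j\in\mathbb{Z}$), and suppose that the CFL condition $$\frac{\tau^\alpha}{h\,\Gamma(2-\alpha)}\Big(\sup_{I}|(f^+)'|+\sup_{I}|(f^-)'|\Big)\le \tilde c,\qquad \tilde c:=2-2^{1-\alpha},$$ holds. Then the scheme is $\ell^1$ contracting: for all $n\ge 1$, $$\sum_{j\in\mathbb{Z}}|U_j^n-V_j^n|\le\sum_{j\in\mathbb{Z}}|U_j^0-V_j^0|.$$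
   Context: The scheme approximates the conservation law $\partial_t^\alpha u+(f(u))_x=0$ with Caputo derivative $\partial_t^\alpha$, on a uniform grid with time step $\tau$ and mesh size $h$. The discrete Caputo derivative is $$D_t^\alpha U_j^{n+1}=\frac{1}{\Gamma(2-\alpha)\tau^\alpha}\Big(U_j^{n+1}-\sum_{k=0}^n c_k^{n+1}U_j^k\Big),\qquad n\ge 0,$$ with $c_0^{n+1}=(n+1)^{1-\alpha}-n^{1-\alpha}$ and $c_k^{n+1}=2(n+1-k)^{1-\alpha}-(n+2-k)^{1-\alpha}-(n-k)^{1-\alpha}$ for $1\le k\le n$ (with $0^{1-\alpha}=0$). Sums of nonnegative terms are taken in $[0,\infty]$. *)

theory Defs
  imports "HOL-Analysis.Analysis"
begin

text \<open>
  The weight \<open>caputo_weight \<alpha> n k\<close> is $c_k^{n+1}$, meaningful for \<open>k \<le> n\<close>.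
  The convention $0^{1-\alpha} = 0$ agrees with \<open>powr\<close>.
\<close>

definition caputo_weight :: "real \<Rightarrow> nat \<Rightarrow> nat \<Rightarrow> real" where
  "caputo_weight \<alpha> n k =
     (if k = 0 then (real n + 1) powr (1 - \<alpha>) - real n powr (1 - \<alpha>)
      else 2 * (real n + 1 - real k) powr (1 - \<alpha>)
             - (real n + 2 - real k) powr (1 - \<alpha>)
             - (real n - real k) powr (1 - \<alpha>))"

text \<open>
  \<open>discrete_caputo \<alpha> \<tau> u n\<close> is the discrete Caputo derivative of the time sequence \<open>u\<close>
  at time level $n+1$ (not $n$).
\<close>

definition discrete_caputo :: "real \<Rightarrow> real \<Rightarrow> (nat \<Rightarrow> real) \<Rightarrow> nat \<Rightarrow> real" where
  "discrete_caputo \<alpha> \<tau> u n =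
     1 / (Gamma (2 - \<alpha>) * \<tau> powr \<alpha>) *
       (u (n + 1) - (\<Sum>k = 0..n. caputo_weight \<alpha> n k * u k))"

text \<open>Grid functions take the time level first: \<open>U n j\<close> is $U_j^n$.\<close>

definition upwind_solution ::
  "real \<Rightarrow> real \<Rightarrow> real \<Rightarrow> (real \<Rightarrow> real) \<Rightarrow> (real \<Rightarrow> real) \<Rightarrow> (nat \<Rightarrow> int \<Rightarrow> real) \<Rightarrow> bool" where
  "upwind_solution \<alpha> \<tau> h fp fm U \<longleftrightarrow>
     (\<forall>(j::int) (n::nat).
        discrete_caputo \<alpha> \<tau> (\<lambda>m. U m j) n
          + 1 / h * (fp (U n j) - fp (U n (j - 1)))
          + 1 / h * (fm (U n (j + 1)) - fm (U n j)) = 0)"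

end

theory Submission
  imports Defs
begin

text \<open>
  By the mean value theorem, each flux difference is a slope times a difference of grid values,
  and the slope is controlled as soon as the grid values lie in \<open>I\<close>. Since the weight of the most
  recent level is at least $2 - 2^{1-\alpha}$, the CFL condition makes every $U_j^{n+1}$ a convex
  combination of earlier grid values, so the scheme never leaves \<open>I\<close>. Applied to the difference
  $W = U - V$, the same computation writes $W_j^{n+1}$ as a nonnegative combination of values of $W$
  in which the coefficients of each $W_i^k$, summed over all \<open>j\<close>, add up to $c_k^{n+1}$. As
  $\sum_k c_k^{n+1} = 1$, strong induction on the time level gives the contraction.

  The scheme naturally involves $\tau^\alpha \Gamma(2-\alpha) / h$, whereas the CFL condition
  bounds $\tau^\alpha / (h\,\Gamma(2-\alpha))$; this is stronger because $\Gamma \le 1$ on $[1,2]$.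
\<close>

section \<open>The Gamma bound and the Caputo weights\<close>

text \<open>Log-convexity: \<open>ln \<circ> Gamma\<close> vanishes at both 1 and 2, so it is at
  most 0 between them.\<close>

lemma Gamma_real_le_one:
  fixes x :: real
  assumes "1 \<le> x" "x \<le> 2"
  shows "Gamma x \<le> 1"
proof -
  have "(ln \<circ> Gamma) ((1 - (x - 1)) *\<^sub>R 1 + (x - 1) *\<^sub>R 2)
          \<le> (1 - (x - 1)) * (ln \<circ> Gamma) 1 + (x - 1) * (ln \<circ> Gamma) (2::real)"
    using assms by (intro convex_onD[OF log_convex_Gamma_real]) auto
  moreover have "(1 - (x - 1)) *\<^sub>R 1 + (x - 1) *\<^sub>R 2 = x"
    by simp
  moreover have "Gamma (2::real) = 1"
    using Gamma_fact[of 1, where 'a = real] by simp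
  ultimately have "ln (Gamma x) \<le> 0"
    by simp
  then show ?thesis
    using Gamma_real_pos[of x] assms by simp
qed

text \<open>Concavity of t^\<beta>: each unit increment is the derivative at an intermediate point,
  and the derivative decreases because \<beta> - 1 \<le> 0.\<close>

lemma powr_increment_antimono:
  fixes x \<beta> :: real
  assumes "0 \<le> x" "0 < \<beta>" "\<beta> \<le> 1"
  shows "(x + 2) powr \<beta> - (x + 1) powr \<beta> \<le> (x + 1) powr \<beta> - x powr \<beta>"
proof -
  have mvt: "\<exists>z. a < z \<and> z < a + 1 \<and> (a + 1) powr \<beta> - a powr \<beta> = \<beta> * z powr (\<beta> - 1)"
    if "0 \<le> a" for a :: real
  proof -
    \<comment> \<open>The left endpoint \<open>a\<close> may be 0, so continuity is shown on the
      closed interval and differentiability only to the right of \<open>a\<close>.\<close>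
    have "continuous_on {a..a + 1} (\<lambda>y. y powr \<beta>)"
      using assms that by (intro continuous_on_powr') (auto intro!: continuous_intros)
    moreover have "(\<lambda>y. y powr \<beta>) differentiable (at y)" if "a < y" for y
      using that \<open>0 \<le> a\<close> has_real_derivative_powr[of y \<beta>]
      by (auto simp: real_differentiable_def)
    ultimately obtain l z where z: "a < z" "z < a + 1"
      and l: "((\<lambda>y. y powr \<beta>) has_real_derivative l) (at z)"
      and "(a + 1) powr \<beta> - a powr \<beta> = (a + 1 - a) * l"
      using MVT[of a "a + 1" "\<lambda>y. y powr \<beta>"] by auto
    moreover have "l = \<beta> * z powr (\<beta> - 1)"
      using DERIV_unique[OF l has_real_derivative_powr] z that by auto
    ultimately show ?thesis by auto
  qed
  obtain z where z: "x < z" "z < x + 1" "(x + 1) powr \<beta> - x powr \<beta> = \<beta> * z powr (\<beta> - 1)"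
    using mvt[of x] assms by auto
  obtain w where w: "x + 1 < w" "(x + 1 + 1) powr \<beta> - (x + 1) powr \<beta> = \<beta> * w powr (\<beta> - 1)"
    using mvt[of "x + 1"] assms by auto
  have "w powr (\<beta> - 1) \<le> z powr (\<beta> - 1)"
    using assms z w by (intro powr_mono2') auto
  then show ?thesis
    using z w assms by (simp add: add.assoc)
qed

text \<open>For k \<ge> 1 the weight is minus a second difference of the concave function
  t^(1-\<alpha>), started at n - k; for k = 0 it is an increment of an increasing function.\<close>

lemma caputo_weight_nonneg:
  assumes "0 < \<alpha>" "\<alpha> < 1" "k \<le> n"
  shows "0 \<le> caputo_weight \<alpha> n k"
proof (cases "k = 0")
  case True
  then show ?thesis
    using assms by (simp add: caputo_weight_def powr_mono2)
next
  case False
  then show ?thesis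
    using powr_increment_antimono[of "real n - real k" "1 - \<alpha>"] assms
    by (simp add: caputo_weight_def algebra_simps)
qed

text \<open>
  The weights are differences of the increments of $t^{1-\alpha}$, so their sum telescopes.
\<close>

lemma sum_caputo_weight:
  assumes "\<alpha> < 1"
  shows "(\<Sum>k\<le>n. caputo_weight \<alpha> n k) = 1"
proof -
  define d where "d = (\<lambda>x::real. (x + 1) powr (1 - \<alpha>) - x powr (1 - \<alpha>))"
  have "(\<Sum>k=1..m. caputo_weight \<alpha> n k) = d (real n - real m) - d (real n)" if "m \<le> n" for m
    using that
  proof (induction m)
    case 0
    then show ?case by simp
  next
    case (Suc m)
    then show ?case
      by (simp add: d_def caputo_weight_def algebra_simps)
  qed
  \<comment> \<open>At m = n the remaining term is \<open>d 0\<close>, which is 1 since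
    \<open>0 powr (1 - \<alpha>)\<close> is 0. The weight for k = 0 is \<open>d n\<close>, which
    completes the sum to 1.\<close>
  then have "(\<Sum>k=1..n. caputo_weight \<alpha> n k) = 1 - d (real n)"
    using assms by (simp add: d_def)
  moreover have "{..n} = insert 0 {1..n}"
    by auto
  ultimately show ?thesis
    by (simp add: caputo_weight_def d_def)
qed

text \<open>Equality holds for n \<ge> 1. For n = 0 the weight is 1, and
  \<open>2 powr (1 - \<alpha>)\<close> is at least 1.\<close>

lemma caputo_weight_last_ge:
  assumes "0 < \<alpha>" "\<alpha> < 1"
  shows "2 - 2 powr (1 - \<alpha>) \<le> caputo_weight \<alpha> n n"
  using ge_one_powr_ge_zero[of 2 "1 - \<alpha>"] assms by (simp add: caputo_weight_def)

section \<open>Explicit form of the scheme and invariance of the interval\<close>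

text \<open>The weight of level n is split off because the fluxes act on that level alone and will
  be absorbed by it.\<close>

lemma upwind_solution_step:
  assumes "upwind_solution \<alpha> \<tau> h fp fm U" "\<alpha> < 1" "0 < \<tau>" "0 < h"
  shows "U (Suc n) j = (\<Sum>k<n. caputo_weight \<alpha> n k * U k j) + caputo_weight \<alpha> n n * U n j
           - (\<tau> powr \<alpha> * Gamma (2 - \<alpha>) / h) * (fp (U n j) - fp (U n (j - 1)))
           - (\<tau> powr \<alpha> * Gamma (2 - \<alpha>) / h) * (fm (U n (j + 1)) - fm (U n j))"
proof -
  have pos: "0 < Gamma (2 - \<alpha>) * \<tau> powr \<alpha>"
    using assms by (intro mult_pos_pos Gamma_real_pos) auto
  have split: "(\<Sum>k=0..n. caputo_weight \<alpha> n k * U k j)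
      = (\<Sum>k<n. caputo_weight \<alpha> n k * U k j) + caputo_weight \<alpha> n n * U n j"
    by (simp add: atLeast0AtMost flip: lessThan_Suc_atMost)
  have "discrete_caputo \<alpha> \<tau> (\<lambda>m. U m j) n
          + 1 / h * (fp (U n j) - fp (U n (j - 1)))
          + 1 / h * (fm (U n (j + 1)) - fm (U n j)) = 0"
    using assms(1) by (simp add: upwind_solution_def)
  then have "(Gamma (2 - \<alpha>) * \<tau> powr \<alpha>) * discrete_caputo \<alpha> \<tau> (\<lambda>m. U m j) n
      = - (Gamma (2 - \<alpha>) * \<tau> powr \<alpha>) * (1 / h * (fp (U n j) - fp (U n (j - 1)))
          + 1 / h * (fm (U n (j + 1)) - fm (U n j)))"
    by (simp add: eq_neg_iff_add_eq_0 add.assoc flip: distrib_left)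
  moreover have "(Gamma (2 - \<alpha>) * \<tau> powr \<alpha>) * discrete_caputo \<alpha> \<tau> (\<lambda>m. U m j) n
      = U (Suc n) j - (\<Sum>k=0..n. caputo_weight \<alpha> n k * U k j)"
    using pos by (auto simp: discrete_caputo_def)
  ultimately show ?thesis
    using split by (simp add: algebra_simps add_divide_distrib diff_divide_distrib)
qed

lemma mvt_is_interval:
  fixes f :: "real \<Rightarrow> real"
  assumes "is_interval I" "a \<in> I" "b \<in> I" "\<And>x. f differentiable (at x)"
  shows "\<exists>\<xi>\<in>I. f b - f a = deriv f \<xi> * (b - a)"
proof -
  have D: "DERIV f x :> deriv f x" for x
    using assms(4) by (simp add: DERIV_deriv_iff_real_differentiable)
  have aux: "\<exists>\<xi>\<in>I. f d - f c = deriv f \<xi> * (d - c)" if cd: "c \<in> I" "d \<in> I" "c < d" for c d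
  proof -
    obtain \<xi> where "c < \<xi>" "\<xi> < d" "f d - f c = (d - c) * deriv f \<xi>"
      using MVT2[OF \<open>c < d\<close> D] by blast
    moreover from this have "\<xi> \<in> I"
      using mem_is_interval_1_I[OF assms(1) cd(1,2)] by simp
    ultimately show ?thesis
      by (auto simp: mult.commute)
  qed
  consider "a < b" | "a = b" | "b < a"
    by linarith
  then show ?thesis
  proof cases
    case 3
    then show ?thesis
      using aux[of b a] assms by (metis minus_diff_eq mult_minus_right)
  qed (use aux[of a b] assms in auto)
qed

text \<open>Two nested convex combinations: dividing the last three terms by \<open>c n\<close>
  gives a point \<open>z\<close> of the hull of \<open>a\<close>, \<open>b\<close>,
  \<open>d\<close>, and \<open>z\<close> then takes the place of the value at level n in the
  weighted sum over time.\<close>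

lemma convex_weighted_update_mem:
  fixes I :: "real set" and c u :: "nat \<Rightarrow> real"
  assumes "convex I"
    and c: "\<And>k. k \<le> n \<Longrightarrow> 0 \<le> c k" "(\<Sum>k\<le>n. c k) = 1" "0 < c n"
    and st: "0 \<le> s" "0 \<le> t" "s + t \<le> c n"
    and I: "a \<in> I" "b \<in> I" "d \<in> I" "\<And>k. k < n \<Longrightarrow> u k \<in> I"
  shows "(\<Sum>k<n. c k * u k) + (c n - s - t) * b + s * a + t * d \<in> I"
proof -
  define z where "z = ((c n - s - t) / c n) *\<^sub>R b + (s / c n) *\<^sub>R a + (t / c n) *\<^sub>R d"
  have "z \<in> convex hull {b, a, d}"
    unfolding convex_hull_3 z_def using c(3) st
    by (intro CollectI exI[of _ "(c n - s - t) / c n"] exI[of _ "s / c n"] exI[of _ "t / c n"])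
      (simp flip: add_divide_distrib)
  then have z: "z \<in> I"
    using I assms(1) hull_minimal[of "{b, a, d}" I convex] by auto
  have "(\<Sum>k\<le>n. c k *\<^sub>R (u(n := z)) k) \<in> I"
    using assms(1) c I z by (intro convex_sum) auto
  moreover have "(\<Sum>k\<le>n. c k *\<^sub>R (u(n := z)) k) = (\<Sum>k<n. c k * u k) + c n * z"
    by (simp flip: lessThan_Suc_atMost)
  moreover have "c n * z = (c n - s - t) * b + s * a + t * d"
    using c(3) by (simp add: z_def field_simps)
  ultimately show ?thesis
    by (simp add: add.assoc)
qed

lemma upwind_solution_mem_interval:
  assumes "0 < \<alpha>" "\<alpha> < 1" "0 < \<tau>" "0 < h"
    and diff: "\<And>x. fp differentiable (at x)" "\<And>x. fm differentiable (at x)"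
    and mono: "\<And>x. 0 \<le> deriv fp x" "\<And>x. deriv fm x \<le> 0"
    and sol: "upwind_solution \<alpha> \<tau> h fp fm U"
    and I: "is_interval I" "\<And>j. U 0 j \<in> I"
    and cfl: "\<And>v w. v \<in> I \<Longrightarrow> w \<in> I \<Longrightarrow>
      \<tau> powr \<alpha> * Gamma (2 - \<alpha>) / h * (deriv fp v - deriv fm w) \<le> 2 - 2 powr (1 - \<alpha>)"
  shows "U n j \<in> I"
proof (induction n arbitrary: j rule: less_induct)
  case (less n)
  show ?case
  proof (cases n)
    case 0
    then show ?thesis using I by simp
  next
    case (Suc m)
    define \<mu> where "\<mu> = \<tau> powr \<alpha> * Gamma (2 - \<alpha>) / h"
    have \<mu>: "0 \<le> \<mu>"
      using assms(2,4) Gamma_real_pos[of "2 - \<alpha>"] by (simp add: \<mu>_def)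
    have IH: "U k i \<in> I" if "k \<le> m" for k i
      using less Suc that by simp
    obtain \<xi> where \<xi>: "\<xi> \<in> I" "fp (U m j) - fp (U m (j - 1)) = deriv fp \<xi> * (U m j - U m (j - 1))"
      using mvt_is_interval[OF I(1) IH IH diff(1)] by blast
    obtain \<eta> where \<eta>: "\<eta> \<in> I" "fm (U m (j + 1)) - fm (U m j) = deriv fm \<eta> * (U m (j + 1) - U m j)"
      using mvt_is_interval[OF I(1) IH IH diff(2)] by blast
    define c where "c = caputo_weight \<alpha> m"
    \<comment> \<open>Strictness, from \<alpha> > 0, makes the last weight positive, as required for
      dividing by it.\<close>
    have "2 powr (1 - \<alpha>) < (2::real) powr 1"
      using assms by (intro powr_less_mono) auto
    then have cm: "0 < c m" "\<mu> * (deriv fp \<xi> - deriv fm \<eta>) \<le> c m"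
      using caputo_weight_last_ge[OF assms(1,2), of m] cfl[OF \<xi>(1) \<eta>(1)]
      by (auto simp: c_def \<mu>_def)
    \<comment> \<open>The \<open>fp\<close> slope shifts weight to the left neighbour and the
      \<open>fm\<close> slope to the right one; the CFL bound keeps the weight left at cell j
      nonnegative.\<close>
    have "(\<Sum>k<m. c k * U k j) + (c m - \<mu> * deriv fp \<xi> - \<mu> * - deriv fm \<eta>) * U m j
        + \<mu> * deriv fp \<xi> * U m (j - 1) + \<mu> * - deriv fm \<eta> * U m (j + 1) \<in> I"
      using I(1) assms(1,2) cm \<mu> mono IH
      by (intro convex_weighted_update_mem)
        (auto simp: is_interval_convex_1 c_def caputo_weight_nonneg sum_caputo_weight algebra_simps
           mult_nonneg_nonpos)
    then show ?thesis
      unfolding Suc upwind_solution_step[OF sol assms(2-4)] \<xi>(2) \<eta>(2) \<mu>_def[symmetric] c_def[symmetric]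
      by (simp add: algebra_simps)
  qed
qed

section \<open>Infinite sums in [0, \<infinity>]\<close>

lemma infsum_add_ennreal:
  fixes f g :: "'a \<Rightarrow> ennreal"
  shows "(\<Sum>\<^sub>\<infinity>x\<in>A. f x + g x) = (\<Sum>\<^sub>\<infinity>x\<in>A. f x) + (\<Sum>\<^sub>\<infinity>x\<in>A. g x)"
  by (intro infsum_add nonneg_summable_on_complete) simp_all

text \<open>The infinite sum is the supremum of the finite ones, and multiplication by a constant
  commutes with suprema in \<open>ennreal\<close>.\<close>

lemma infsum_cmult_right_ennreal:
  fixes f :: "'a \<Rightarrow> ennreal"
  shows "(\<Sum>\<^sub>\<infinity>x\<in>A. c * f x) = c * (\<Sum>\<^sub>\<infinity>x\<in>A. f x)"
  by (simp add: nonneg_infsum_complete SUP_mult_left_ennreal flip: sum_distrib_left)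

lemma infsum_sum_ennreal:
  fixes f :: "'b \<Rightarrow> 'a \<Rightarrow> ennreal"
  shows "(\<Sum>\<^sub>\<infinity>x\<in>A. \<Sum>k\<in>F. f k x) = (\<Sum>k\<in>F. \<Sum>\<^sub>\<infinity>x\<in>A. f k x)"
  by (induction F rule: infinite_finite_induct) (simp_all add: infsum_add_ennreal)

lemma infsum_int_shift:
  fixes g :: "int \<Rightarrow> 'b::{comm_monoid_add, t2_space}"
  shows "(\<Sum>\<^sub>\<infinity>j. g (j + i)) = (\<Sum>\<^sub>\<infinity>j. g j)"
  by (rule infsum_reindex_bij_witness[where i = "\<lambda>j. j - i" and j = "\<lambda>j. j + i"]) auto

text \<open>
  The mass \<open>c * w j\<close> of each cell is redistributed to the cell itself and its two neighbours.
\<close>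

lemma infsum_redistribute_ennreal:
  fixes p q w :: "int \<Rightarrow> real"
  assumes "\<And>j. 0 \<le> p j" "\<And>j. 0 \<le> q j" "\<And>j. p j + q j \<le> c" "\<And>j. 0 \<le> w j"
  shows "(\<Sum>\<^sub>\<infinity>j. ennreal ((c - p j - q j) * w j + p (j - 1) * w (j - 1) + q (j + 1) * w (j + 1)))
       = (\<Sum>\<^sub>\<infinity>j. ennreal (c * w j))"
proof -
  define r where "r j = c - p j - q j" for j
  have r: "0 \<le> r j" "c = r j + p j + q j" for j
    using assms(3)[of j] by (auto simp: r_def)
  \<comment> \<open>Writing j - 1 as j + - 1 puts the sum into the form of
    \<open>infsum_int_shift\<close>.\<close>
  have "(\<Sum>\<^sub>\<infinity>j. ennreal (r j * w j + p (j - 1) * w (j - 1) + q (j + 1) * w (j + 1)))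
      = (\<Sum>\<^sub>\<infinity>j. ennreal (r j * w j)) + (\<Sum>\<^sub>\<infinity>j. ennreal (p (j + - 1) * w (j + - 1)))
        + (\<Sum>\<^sub>\<infinity>j. ennreal (q (j + 1) * w (j + 1)))"
    using assms r(1) by (simp add: infsum_add_ennreal ennreal_plus)
  also have "\<dots> = (\<Sum>\<^sub>\<infinity>j. ennreal (r j * w j)) + (\<Sum>\<^sub>\<infinity>j. ennreal (p j * w j))
        + (\<Sum>\<^sub>\<infinity>j. ennreal (q j * w j))"
    using infsum_int_shift[of "\<lambda>j. ennreal (p j * w j)" "- 1"]
      infsum_int_shift[of "\<lambda>j. ennreal (q j * w j)" 1] by simp
  also have "\<dots> = (\<Sum>\<^sub>\<infinity>j. ennreal (r j * w j + p j * w j + q j * w j))"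
    using assms r(1) by (simp add: infsum_add_ennreal ennreal_plus)
  also have "\<dots> = (\<Sum>\<^sub>\<infinity>j. ennreal (c * w j))"
    using r(2) by (metis distrib_right)
  finally show ?thesis
    by (simp add: r_def)
qed

section \<open>The l1 estimate and the contraction\<close>

text \<open>Only level n has to lie in \<open>I\<close>, since earlier levels enter the scheme
  linearly.\<close>

lemma upwind_solution_l1_step:
  assumes "0 < \<alpha>" "\<alpha> < 1" "0 < \<tau>" "0 < h"
    and diff: "\<And>x. fp differentiable (at x)" "\<And>x. fm differentiable (at x)"
    and mono: "\<And>x. 0 \<le> deriv fp x" "\<And>x. deriv fm x \<le> 0"
    and sol: "upwind_solution \<alpha> \<tau> h fp fm U" "upwind_solution \<alpha> \<tau> h fp fm V"
    and I: "is_interval I" "\<And>j. U n j \<in> I" "\<And>j. V n j \<in> I"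
    and cfl: "\<And>v w. v \<in> I \<Longrightarrow> w \<in> I \<Longrightarrow>
      \<tau> powr \<alpha> * Gamma (2 - \<alpha>) / h * (deriv fp v - deriv fm w) \<le> 2 - 2 powr (1 - \<alpha>)"
  shows "(\<Sum>\<^sub>\<infinity>j. ennreal \<bar>U (Suc n) j - V (Suc n) j\<bar>)
     \<le> (\<Sum>k\<le>n. ennreal (caputo_weight \<alpha> n k) * (\<Sum>\<^sub>\<infinity>j. ennreal \<bar>U k j - V k j\<bar>))"
proof -
  define \<mu> where "\<mu> = \<tau> powr \<alpha> * Gamma (2 - \<alpha>) / h"
  define c where "c = caputo_weight \<alpha> n"
  define W where "W k j = U k j - V k j" for k j
  have \<mu>: "0 \<le> \<mu>"
    using assms(2,4) Gamma_real_pos[of "2 - \<alpha>"] by (simp add: \<mu>_def)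
  have c: "0 \<le> c k" if "k \<le> n" for k
    using caputo_weight_nonneg[OF assms(1,2) that] by (simp add: c_def)
  \<comment> \<open>Here the mean value theorem compares the two solutions in one cell, not
    neighbouring cells of one solution.\<close>
  have "\<exists>\<xi>\<in>I. fp (U n j) - fp (V n j) = deriv fp \<xi> * W n j" for j
    unfolding W_def using I by (intro mvt_is_interval diff)
  then obtain \<xi> where \<xi>: "\<And>j. \<xi> j \<in> I" "\<And>j. fp (U n j) - fp (V n j) = deriv fp (\<xi> j) * W n j"
    by metis
  have "\<exists>\<eta>\<in>I. fm (U n j) - fm (V n j) = deriv fm \<eta> * W n j" for j
    unfolding W_def using I by (intro mvt_is_interval diff)
  then obtain \<eta> where \<eta>: "\<And>j. \<eta> j \<in> I" "\<And>j. fm (U n j) - fm (V n j) = deriv fm (\<eta> j) * W n j"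
    by metis
  define p q where "p j = \<mu> * deriv fp (\<xi> j)" and "q j = \<mu> * - deriv fm (\<eta> j)" for j
  have p: "0 \<le> p j" and q: "0 \<le> q j" for j
    using \<mu> mono by (auto simp: p_def q_def mult_nonneg_nonpos)
  have pq: "p j + q j \<le> c n" for j
    using cfl[OF \<xi>(1) \<eta>(1), of j j] caputo_weight_last_ge[OF assms(1,2), of n]
    by (simp add: p_def q_def c_def right_diff_distrib flip: \<mu>_def)
  define E where "E j = (c n - p j - q j) * \<bar>W n j\<bar> + p (j - 1) * \<bar>W n (j - 1)\<bar>
      + q (j + 1) * \<bar>W n (j + 1)\<bar>" for j
  have E: "0 \<le> E j" for j
    using p q pq[of j] by (auto simp: E_def)
  \<comment> \<open>The slopes are indexed by the cell that gives away mass, so the coefficients of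
    each \<open>W n i\<close> over all receiving cells add up to \<open>c n\<close>.\<close>
  have W_Suc: "W (Suc n) j = (\<Sum>k<n. c k * W k j) + (c n - p j - q j) * W n j
      + p (j - 1) * W n (j - 1) + q (j + 1) * W n (j + 1)" for j
  proof -
    have "W (Suc n) j = (\<Sum>k<n. c k * W k j) + c n * W n j
        - \<mu> * (fp (U n j) - fp (V n j)) + \<mu> * (fp (U n (j - 1)) - fp (V n (j - 1)))
        - \<mu> * (fm (U n (j + 1)) - fm (V n (j + 1))) + \<mu> * (fm (U n j) - fm (V n j))"
      unfolding W_def upwind_solution_step[OF sol(1) assms(2-4)]
        upwind_solution_step[OF sol(2) assms(2-4)] \<mu>_def[symmetric] c_def[symmetric]
      by (simp add: right_diff_distrib sum_subtractf)
    then show ?thesis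
      unfolding \<xi>(2) \<eta>(2) by (simp add: p_def q_def algebra_simps)
  qed
  \<comment> \<open>All coefficients are nonnegative, so the triangle inequality leaves them
    unchanged.\<close>
  have "\<bar>W (Suc n) j\<bar> \<le> (\<Sum>k<n. c k * \<bar>W k j\<bar>) + E j" for j
  proof -
    have "\<bar>\<Sum>k<n. c k * W k j\<bar> \<le> (\<Sum>k<n. c k * \<bar>W k j\<bar>)"
      using c by (intro order_trans[OF sum_abs] sum_mono) (simp add: abs_mult)
    moreover have "\<bar>(c n - p j - q j) * W n j\<bar> = (c n - p j - q j) * \<bar>W n j\<bar>"
      using pq[of j] by (simp add: abs_mult)
    moreover have "\<bar>p i * W n i\<bar> = p i * \<bar>W n i\<bar>" "\<bar>q i * W n i\<bar> = q i * \<bar>W n i\<bar>" for i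
      using p[of i] q[of i] by (simp_all add: abs_mult)
    ultimately show ?thesis
      unfolding W_Suc E_def by (smt (verit))
  qed
  then have "(\<Sum>\<^sub>\<infinity>j. ennreal \<bar>W (Suc n) j\<bar>) \<le> (\<Sum>\<^sub>\<infinity>j. ennreal ((\<Sum>k<n. c k * \<bar>W k j\<bar>) + E j))"
    by (intro infsum_mono nonneg_summable_on_complete) (auto intro: ennreal_leI)
  also have "\<dots> = (\<Sum>\<^sub>\<infinity>j. (\<Sum>k<n. ennreal (c k) * ennreal \<bar>W k j\<bar>) + ennreal (E j))"
  proof (rule infsum_cong)
    fix j
    have "ennreal ((\<Sum>k<n. c k * \<bar>W k j\<bar>) + E j) = ennreal (\<Sum>k<n. c k * \<bar>W k j\<bar>) + ennreal (E j)"
      using c E by (intro ennreal_plus sum_nonneg) auto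
    also have "ennreal (\<Sum>k<n. c k * \<bar>W k j\<bar>) = (\<Sum>k<n. ennreal (c k * \<bar>W k j\<bar>))"
      using c by (intro sum_ennreal[symmetric]) auto
    also have "\<dots> = (\<Sum>k<n. ennreal (c k) * ennreal \<bar>W k j\<bar>)"
      using c by (intro sum.cong) (auto simp: ennreal_mult)
    finally show "ennreal ((\<Sum>k<n. c k * \<bar>W k j\<bar>) + E j)
        = (\<Sum>k<n. ennreal (c k) * ennreal \<bar>W k j\<bar>) + ennreal (E j)" .
  qed
  also have "\<dots> = (\<Sum>k<n. ennreal (c k) * (\<Sum>\<^sub>\<infinity>j. ennreal \<bar>W k j\<bar>)) + (\<Sum>\<^sub>\<infinity>j. ennreal (E j))"
    by (simp add: infsum_add_ennreal infsum_sum_ennreal infsum_cmult_right_ennreal)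
  also have "(\<Sum>\<^sub>\<infinity>j. ennreal (E j)) = (\<Sum>\<^sub>\<infinity>j. ennreal (c n * \<bar>W n j\<bar>))"
    unfolding E_def using p q pq by (intro infsum_redistribute_ennreal) auto
  also have "\<dots> = ennreal (c n) * (\<Sum>\<^sub>\<infinity>j. ennreal \<bar>W n j\<bar>)"
    using c by (simp add: ennreal_mult infsum_cmult_right_ennreal)
  finally show ?thesis
    by (simp add: W_def c_def flip: lessThan_Suc_atMost)
qed

theorem theorem3p2:
  fixes \<alpha> \<tau> h :: real
    and f fp fm :: "real \<Rightarrow> real"
    and U V :: "nat \<Rightarrow> int \<Rightarrow> real"
    and I :: "real set"
  assumes "0 < \<alpha>" and "\<alpha> < 1" and "0 < \<tau>" and "0 < h"
    and "\<And>x. f x = fp x + fm x"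
    and "fp C1_differentiable_on UNIV" and "fm C1_differentiable_on UNIV"
    and "\<And>x. 0 \<le> deriv fp x" and "\<And>x. deriv fm x \<le> 0"
    and "upwind_solution \<alpha> \<tau> h fp fm U" and "upwind_solution \<alpha> \<tau> h fp fm V"
    and "is_interval I" and "\<And>j. U 0 j \<in> I" and "\<And>j. V 0 j \<in> I"
    and "ennreal (\<tau> powr \<alpha> / (h * Gamma (2 - \<alpha>))) *
           ((SUP v\<in>I. ennreal \<bar>deriv fp v\<bar>) + (SUP v\<in>I. ennreal \<bar>deriv fm v\<bar>))
         \<le> ennreal (2 - 2 powr (1 - \<alpha>))"
  shows "\<forall>n\<ge>1. (\<Sum>\<^sub>\<infinity>j\<in>UNIV. ennreal \<bar>U n j - V n j\<bar>)
                 \<le> (\<Sum>\<^sub>\<infinity>j\<in>UNIV. ennreal \<bar>U 0 j - V 0 j\<bar>)"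
proof -
  have diff: "fp differentiable (at x)" "fm differentiable (at x)" for x
    using assms(6,7) by (auto simp: C1_differentiable_on_eq)
  have Gamma: "0 < Gamma (2 - \<alpha>)" "Gamma (2 - \<alpha>) \<le> 1"
    using assms(1,2) by (auto intro: Gamma_real_pos Gamma_real_le_one)
  have cfl: "\<tau> powr \<alpha> * Gamma (2 - \<alpha>) / h * (deriv fp v - deriv fm w) \<le> 2 - 2 powr (1 - \<alpha>)"
    if "v \<in> I" "w \<in> I" for v w
  proof -
    define \<kappa> where "\<kappa> = \<tau> powr \<alpha> / (h * Gamma (2 - \<alpha>))"
    have \<kappa>: "0 \<le> \<kappa>"
      using assms(4) Gamma(1) by (simp add: \<kappa>_def)
    \<comment> \<open>The suprema may be infinite, so the passage to single points of
      \<open>I\<close> is made in \<open>ennreal\<close>.\<close>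
    have "ennreal \<kappa> * (ennreal \<bar>deriv fp v\<bar> + ennreal \<bar>deriv fm w\<bar>)
        \<le> ennreal \<kappa> * ((SUP v\<in>I. ennreal \<bar>deriv fp v\<bar>) + (SUP v\<in>I. ennreal \<bar>deriv fm v\<bar>))"
      using that by (intro mult_left_mono add_mono SUP_upper) auto
    also have "\<dots> \<le> ennreal (2 - 2 powr (1 - \<alpha>))"
      using assms(15) by (simp add: \<kappa>_def)
    finally have "ennreal (\<kappa> * (\<bar>deriv fp v\<bar> + \<bar>deriv fm w\<bar>)) \<le> ennreal (2 - 2 powr (1 - \<alpha>))"
      using \<kappa> by (simp add: ennreal_mult)
    \<comment> \<open>Since \<open>ennreal\<close> sends negative numbers to 0, returning to the
      reals requires a nonnegative right-hand side.\<close>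
    moreover have "(2::real) powr (1 - \<alpha>) \<le> 2 powr 1"
      using assms(1) by (intro powr_mono) auto
    ultimately have "\<kappa> * (deriv fp v - deriv fm w) \<le> 2 - 2 powr (1 - \<alpha>)"
      using assms(8)[of v] assms(9)[of w] by (simp add: ennreal_le_iff)
    \<comment> \<open>The factor of the scheme is \<kappa> times the square of
      \<open>Gamma (2 - \<alpha>)\<close>.\<close>
    moreover have "Gamma (2 - \<alpha>) * Gamma (2 - \<alpha>) \<le> 1"
      using Gamma by (simp add: mult_le_one)
    then have "\<tau> powr \<alpha> * Gamma (2 - \<alpha>) / h \<le> \<kappa>"
      using Gamma(1) assms(3,4) by (simp add: \<kappa>_def field_simps)
    then have "\<tau> powr \<alpha> * Gamma (2 - \<alpha>) / h * (deriv fp v - deriv fm w)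
        \<le> \<kappa> * (deriv fp v - deriv fm w)"
      using assms(8)[of v] assms(9)[of w] by (intro mult_right_mono) auto
    ultimately show ?thesis
      by simp
  qed
  have U: "U n j \<in> I" and V: "V n j \<in> I" for n j
    using upwind_solution_mem_interval[OF assms(1-4) diff assms(8,9)] assms(10-14) cfl by blast+
  let ?S = "\<lambda>n. \<Sum>\<^sub>\<infinity>j. ennreal \<bar>U n j - V n j\<bar>"
  have "?S n \<le> ?S 0" for n
  proof (induction n rule: less_induct)
    case (less n)
    show ?case
    proof (cases n)
      case 0
      then show ?thesis by simp
    next
      case (Suc m)
      have "?S (Suc m) \<le> (\<Sum>k\<le>m. ennreal (caputo_weight \<alpha> m k) * ?S k)"
        by (rule upwind_solution_l1_step[OF assms(1-4) diff assms(8-12) U V cfl])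
      also have "\<dots> \<le> (\<Sum>k\<le>m. ennreal (caputo_weight \<alpha> m k) * ?S 0)"
        using less Suc by (intro sum_mono mult_left_mono) auto
      \<comment> \<open>Nonnegative weights can be summed in the reals first; their total 1 keeps
        the bound valid even when the initial distance is infinite.\<close>
      also have "\<dots> = ennreal (\<Sum>k\<le>m. caputo_weight \<alpha> m k) * ?S 0"
        using caputo_weight_nonneg[OF assms(1,2), of _ m]
        by (subst sum_ennreal[symmetric]) (auto simp: sum_distrib_right)
      also have "\<dots> = ?S 0"
        by (simp add: sum_caputo_weight[OF assms(2)])
      finally show ?thesis
        using Suc by simp
    qed
  qed
  then show ?thesis
    by blast
qed

end
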